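(* Let $0<u\le1$ and put $\sigma:=u^{1/4}$, $A:=\arcsin\sigma$, $B:=\operatorname{arsinh}\sigma$. For every integer $m\ge0$, $$\sum_{r=0}^{\infty}\frac{\binom{4r}{2r}}{16^r(4r+1)}t_{2r}(\{2\}^m)u^r=\frac{A^{2m+1}+(-1)^mB^{2m+1}}{2(2m+1)!\,\sigma},$$ $$\sum_{r=0}^{\infty}\frac{\binom{4r+2}{2r+1}}{2^{4r+2}(4r+3)}t_{2r+1}(\{2\}^m)u^r=\frac{A^{2m+1}-(-1)^mB^{2m+1}}{2(2m+1)!\,\sigma^3}.$$ For every integer $m\ge1$, $$\sum_{r=1}^{\infty}\frac{16^ru^r}{r^2\binom{4r}{2r}}\zeta_{2r-1}(\{2\}^{m-1})=\frac{2^{2m+1}}{(2m)!}\left(A^{2m}+(-1)^mB^{2m}\right),$$ $$\sum_{r=0}^{\infty}\frac{4^{2r+1}u^r}{(2r+1)^2\binom{4r+2}{2r+1}}\zeta_{2r}(\{2\}^{m-1})=\frac{2^{2m-1}}{\sigma^2(2m)!}\left(A^{2m}-(-1)^mB^{2m}\right).$$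
   Context: For integers $n\ge0$, $m\ge0$, the finite repeated-$2$ sums are $$\zeta_n(\{2\}^m):=\sum_{n\ge n_1>\cdots>n_m\ge1}\frac1{n_1^2\cdots n_m^2},\qquad t_n(\{2\}^m):=\sum_{n\ge n_1>\cdots>n_m\ge1}\frac1{(2n_1-1)^2\cdots(2n_m-1)^2},$$ with the value $1$ when $m=0$ and the value $0$ when $m>n$. *)

theory Defs
  imports "HOL-Analysis.Analysis"
begin

text \<open>
  The index set of the finite nested sums: the tuples \<open>n \<ge> n\<^sub>1 > \<dots> > n\<^sub>m \<ge> 1\<close>,
  encoded as strictly decreasing lists of length \<open>m\<close>. It is \<open>{[]}\<close> for \<open>m = 0\<close>, so the
  nested sums are then 1, and empty for \<open>m > n\<close>, so they are then 0 (proved below).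
\<close>

definition decr_tuples :: "nat \<Rightarrow> nat \<Rightarrow> nat list set" where
  "decr_tuples n m = {ns. length ns = m \<and> sorted_wrt (>) ns \<and> set ns \<subseteq> {1..n}}"

definition zeta2 :: "nat \<Rightarrow> nat \<Rightarrow> real" where
  "zeta2 n m = (\<Sum>ns\<in>decr_tuples n m. \<Prod>i<m. 1 / (real (ns ! i))\<^sup>2)"

definition t2 :: "nat \<Rightarrow> nat \<Rightarrow> real" where
  "t2 n m = (\<Sum>ns\<in>decr_tuples n m. \<Prod>i<m. 1 / (2 * real (ns ! i) - 1)\<^sup>2)"

lemma finite_decr_tuples: "finite (decr_tuples n m)"
  by (rule finite_subset[OF _ finite_lists_length_eq[of "{1..n}" m]])
     (auto simp: decr_tuples_def)

lemma decr_tuples_0: "decr_tuples n 0 = {[]}"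
  by (auto simp: decr_tuples_def)

lemma decr_tuples_empty:
  assumes "m > n"
  shows "decr_tuples n m = {}"
proof -
  have "length ns \<le> n" if "sorted_wrt (>) ns" "set ns \<subseteq> {1..n}" for ns :: "nat list"
  proof -
    have "distinct ns"
      using that(1) by (induction ns) auto
    then have "length ns = card (set ns)"
      by (simp add: distinct_card)
    also have "\<dots> \<le> card {1..n}"
      using that(2) by (intro card_mono) auto
    finally show ?thesis by simp
  qed
  with assms show ?thesis
    by (fastforce simp: decr_tuples_def)
qed

lemma zeta2_0: "zeta2 n 0 = 1" and t2_0: "t2 n 0 = 1"
  by (simp_all add: zeta2_def t2_def decr_tuples_0)

lemma zeta2_eq_0: "m > n \<Longrightarrow> zeta2 n m = 0" and t2_eq_0: "m > n \<Longrightarrow> t2 n m = 0"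
  by (simp_all add: zeta2_def t2_def decr_tuples_empty)

end

theory Submission
  imports Defs "HOL-Complex_Analysis.Complex_Analysis"
begin

text \<open>
  The functions \<open>h\<^sub>k = arcsin\<^sup>k / k!\<close> satisfy \<open>(1 - z\<^sup>2) h\<^sub>k'' - z h\<^sub>k' = h\<^sub>k\<^sub>-\<^sub>2\<close>, which is a
  recurrence for their Taylor coefficients at 0. Central binomial coefficients
  times \<open>t\<^sub>n({2}\<^sup>m)\<close> (odd \<open>k\<close>) and their inverses times \<open>\<zeta>\<^sub>n({2}\<^sup>m)\<close> (even \<open>k\<close>), suitably
  normalised, satisfy the same recurrence. The series at \<open>z = \<sigma>\<close> and at \<open>z = \<i>\<sigma>\<close>, where \<open>arcsin (\<i>\<sigma>) = \<i> arsinh \<sigma>\<close>, differ by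
  alternating signs, so half their sum and half their difference select the terms of even and
  of odd index. The coefficients are nonnegative, so the case \<open>\<sigma> = 1\<close> on the boundary of the disc
  of convergence follows by letting \<open>\<sigma>\<close> tend to 1.
\<close>

section \<open>Recurrences for the nested sums and the central binomial coefficients\<close>

text \<open>A strictly decreasing tuple can contain the largest admissible value
  \<open>Suc n\<close> only as its head; the tuples split according to whether it occurs.\<close>

lemma decr_tuples_Suc_Suc:
  "decr_tuples (Suc n) (Suc m) = decr_tuples n (Suc m) \<union> (#) (Suc n) ` decr_tuples n m"
proof (intro set_eqI iffI)
  fix ns assume ns: "ns \<in> decr_tuples (Suc n) (Suc m)"
  then obtain a as where as: "ns = a # as" "length as = m" "sorted_wrt (>) as"
      "\<forall>x\<in>set as. x < a" "a \<le> Suc n" "1 \<le> a" "set as \<subseteq> {1..Suc n}"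
    by (cases ns) (auto simp: decr_tuples_def)
  then show "ns \<in> decr_tuples n (Suc m) \<union> (#) (Suc n) ` decr_tuples n m"
    by (cases "a = Suc n") (fastforce simp: decr_tuples_def)+
qed (fastforce simp: decr_tuples_def)

text \<open>The two parts of the index set are disjoint, and in the second the factor of the head
  comes out of the sum. The weight \<open>f\<close> is arbitrary so that \<open>zeta2\<close> and
  \<open>t2\<close> are both covered.\<close>

lemma sum_decr_tuples_Suc_Suc:
  fixes f :: "nat \<Rightarrow> real"
  shows "(\<Sum>ns\<in>decr_tuples (Suc n) (Suc m). \<Prod>i<Suc m. f (ns ! i)) =
    (\<Sum>ns\<in>decr_tuples n (Suc m). \<Prod>i<Suc m. f (ns ! i)) +
    f (Suc n) * (\<Sum>ns\<in>decr_tuples n m. \<Prod>i<m. f (ns ! i))"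
proof -
  have "decr_tuples n (Suc m) \<inter> (#) (Suc n) ` decr_tuples n m = {}"
    by (auto simp: decr_tuples_def)
  then show ?thesis
    unfolding decr_tuples_Suc_Suc
    by (simp add: sum.union_disjoint finite_decr_tuples sum.reindex sum_distrib_left
        prod.lessThan_Suc_shift del: prod.lessThan_Suc)
qed

lemma zeta2_Suc_Suc: "zeta2 (Suc n) (Suc m) = zeta2 n (Suc m) + zeta2 n m / (real n + 1)\<^sup>2"
  using sum_decr_tuples_Suc_Suc[where f = "\<lambda>k. 1 / (real k)\<^sup>2" and n = n and m = m]
  by (simp add: zeta2_def add.commute)

lemma t2_Suc_Suc: "t2 (Suc n) (Suc m) = t2 n (Suc m) + t2 n m / (2 * real n + 1)\<^sup>2"
  using sum_decr_tuples_Suc_Suc[where f = "\<lambda>k. 1 / (2 * real k - 1)\<^sup>2" and n = n and m = m]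
  by (simp add: t2_def)

text \<open>Absorption in rows \<open>2 * n + 2\<close> and \<open>2 * n + 1\<close>, joined by the
  equality of the two middle entries of row \<open>2 * n + 1\<close>.\<close>

lemma central_binomial_Suc:
  "real ((2 * Suc n) choose Suc n) = real ((2 * n) choose n) * (2 * (2 * real n + 1)) / (real n + 1)"
proof -
  have 1: "Suc n * ((2 * n + 2) choose Suc n) = (2 * n + 2) * ((2 * n + 1) choose n)"
    using Suc_times_binomial[of n "2 * n + 1"] by simp
  have 2: "Suc n * ((2 * n + 1) choose Suc n) = (2 * n + 1) * ((2 * n) choose n)"
    using Suc_times_binomial[of n "2 * n"] by simp
  have 3: "(2 * n + 1) choose Suc n = (2 * n + 1) choose n"
    using binomial_symmetric[of n "2 * n + 1"] by simp
  have "Suc n * ((2 * n + 2) choose Suc n) = Suc n * (2 * ((2 * n + 1) choose n))"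
    unfolding 1 by simp
  then have "(2 * n + 2) choose Suc n = 2 * ((2 * n + 1) choose n)"
    unfolding mult_cancel1 by simp
  then have "Suc n * ((2 * n + 2) choose Suc n) = 2 * (2 * n + 1) * ((2 * n) choose n)"
    using 2 3 by (metis mult.assoc mult.left_commute)
  then have "real (Suc n * ((2 * Suc n) choose Suc n)) = real (2 * (2 * n + 1) * ((2 * n) choose n))"
    by (metis mult_Suc_right add.commute)
  then show ?thesis
    by (simp del: binomial_Suc_Suc add: field_simps)
qed

text \<open>The Taylor coefficients of \<open>h\<^sub>k\<close>.\<close>

fun arcsin_coeff :: "nat \<Rightarrow> nat \<Rightarrow> real" where
  "arcsin_coeff k 0 = (if k = 0 then 1 else 0)"
| "arcsin_coeff k (Suc 0) = (if k = 1 then 1 else 0)"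
| "arcsin_coeff k (Suc (Suc j)) =
    ((real j)\<^sup>2 * arcsin_coeff k j + (if k \<ge> 2 then arcsin_coeff (k - 2) j else 0)) /
    ((real j + 1) * (real j + 2))"

section \<open>Sign, parity and closed forms of the coefficients\<close>

lemma arcsin_coeff_nonneg: "arcsin_coeff k j \<ge> 0"
  by (induction k j rule: arcsin_coeff.induct) auto

text \<open>The recurrence only links pairs with the same parity of \<open>k + j\<close>, and the
  nonzero initial values sit at (0, 0) and (1, 1).\<close>

lemma arcsin_coeff_eq_0: "odd (k + j) \<Longrightarrow> arcsin_coeff k j = 0"
  by (induction k j rule: arcsin_coeff.induct) (auto elim: oddE)

lemma arcsin_coeff_0_left: "arcsin_coeff 0 j = (if j = 0 then 1 else 0)"
  by (induction "0::nat" j rule: arcsin_coeff.induct) auto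

text \<open>With \<open>j = 2 * n + 1\<close>, the factor \<open>j^2 / ((j + 1) * (j + 2))\<close>
  of the recurrence is exactly the quotient of consecutive prefactors. What remains is the
  recurrence of \<open>t2\<close>, whose increment comes from row \<open>k - 2\<close>.\<close>

lemma arcsin_coeff_odd:
  "arcsin_coeff (2 * m + 1) (2 * n + 1) =
    real ((2 * n) choose n) / (4 ^ n * (2 * real n + 1)) * t2 n m"
proof (induction n arbitrary: m)
  case 0
  then show ?case by (cases m) (simp_all add: t2_0 t2_eq_0)
next
  case (Suc n)
  have t: "t2 (Suc n) m =
      t2 n m + (if m \<ge> 1 then t2 n (m - 1) / (2 * real n + 1)\<^sup>2 else 0)"
    by (cases m) (simp_all add: t2_0 t2_Suc_Suc)
  have rec: "arcsin_coeff (2 * m + 1) (2 * Suc n + 1) =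
      ((2 * real n + 1)\<^sup>2 * arcsin_coeff (2 * m + 1) (2 * n + 1) +
       (if m \<ge> 1 then arcsin_coeff (2 * (m - 1) + 1) (2 * n + 1) else 0)) /
      ((2 * real n + 2) * (2 * real n + 3))"
    by (cases m) (simp_all add: add.commute)
  have pos: "2 * real n + 1 > 0" "2 * real n + 2 > 0" "2 * real n + 3 > 0" "real n + 1 > 0"
    by auto
  \<comment> \<open>The induction step with \<open>s = 2n + 1\<close>, \<open>q = 4^n\<close>,
    \<open>p = n + 1\<close>, \<open>r = 2n + 3\<close> and \<open>b\<close> the central binomial
    coefficient as free variables, so that it is a plain field identity.\<close>
  have alg: "(s\<^sup>2 * (b / (q * s) * x) + b / (q * s) * y) / ((2 * p) * r) =
      b * (2 * s) / p / (4 * q * r) * (x + y / s\<^sup>2)"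
    if "s > 0" "q > 0" "p > 0" "r > 0" for s b q x y p r :: real
    using that by (simp add: field_simps power2_eq_square)
  have *: "((2 * real n + 1)\<^sup>2 * (real ((2 * n) choose n) / (4 ^ n * (2 * real n + 1)) * x) +
       real ((2 * n) choose n) / (4 ^ n * (2 * real n + 1)) * y) /
      ((2 * real n + 2) * (2 * real n + 3)) =
    real ((2 * Suc n) choose Suc n) / (4 ^ Suc n * (2 * real (Suc n) + 1)) *
      (x + y / (2 * real n + 1)\<^sup>2)" for x y
    unfolding central_binomial_Suc
    using alg[of "2 * real n + 1" "4 ^ n" "real n + 1" "2 * real n + 3"
        "real ((2 * n) choose n)" x y] pos
    by (simp add: algebra_simps)
  show ?case
    unfolding rec Suc.IH t
    using *[of "t2 n m" "if m \<ge> 1 then t2 n (m - 1) else 0"] by (cases "m \<ge> 1") simp_all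
qed

text \<open>The argument is that of the odd case with \<open>j = 2 * Suc n\<close>. Here the
  increment carries \<open>1 / (2n + 2)^2\<close>, a quarter of that of \<open>zeta2\<close>, so
  each step in \<open>m\<close> costs a factor 4; this explains \<open>4 ^ Suc m\<close>.\<close>

lemma arcsin_coeff_even:
  "arcsin_coeff (2 * Suc m) (2 * Suc n) =
    4 ^ Suc n / ((real n + 1)\<^sup>2 * real ((2 * Suc n) choose Suc n)) / 4 ^ Suc m * zeta2 n m"
proof (induction n arbitrary: m)
  case 0
  then show ?case by (cases m) (simp_all add: zeta2_0 zeta2_eq_0 numeral_2_eq_2)
next
  case (Suc n)
  define b where "b = real ((2 * Suc n) choose Suc n)"
  have b: "b > 0" unfolding b_def of_nat_0_less_iff by (rule zero_less_binomial) simp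
  have t: "zeta2 (Suc n) m =
      zeta2 n m + (if m \<ge> 1 then zeta2 n (m - 1) / (real n + 1)\<^sup>2 else 0)"
    by (cases m) (simp_all add: zeta2_0 zeta2_Suc_Suc)
  have rec: "arcsin_coeff (2 * Suc m) (2 * Suc (Suc n)) =
      ((2 * real n + 2)\<^sup>2 * arcsin_coeff (2 * Suc m) (2 * Suc n) +
       (if m \<ge> 1 then arcsin_coeff (2 * Suc (m - 1)) (2 * Suc n) else 0)) /
      ((2 * real n + 3) * (2 * real n + 4))"
  proof -
    have "2 * Suc (Suc n) = Suc (Suc (2 * Suc n))" "2 * Suc m - 2 = 2 * m" "2 \<le> 2 * Suc m"
      and "real (2 * Suc n) = 2 * real n + 2" "2 * real n + 2 + 1 = 2 * real n + 3"
        "2 * real n + 2 + 2 = 2 * real n + 4"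
      by auto
    \<comment> \<open>For \<open>m = 0\<close> the inhomogeneous term is a coefficient of positive
      index of the constant function 1, hence 0.\<close>
    moreover have "arcsin_coeff (2 * m) (2 * Suc n) =
        (if m \<ge> 1 then arcsin_coeff (2 * Suc (m - 1)) (2 * Suc n) else 0)"
      using arcsin_coeff_0_left[of "2 * Suc n"] by (cases m) (simp_all del: arcsin_coeff.simps)
    ultimately show ?thesis
      by (simp only: arcsin_coeff.simps(3) if_True)
  qed
  have alg: "((2 * p)\<^sup>2 * (q / (p\<^sup>2 * b) / w * x) + q / (p\<^sup>2 * b) / w * (4 * y)) / (s * (2 * r)) =
      4 * q / (r\<^sup>2 * (b * (2 * s) / r)) / w * (x + y / p\<^sup>2)"
    if "s > 0" "q > 0" "p > 0" "r > 0" "w > 0" for s q x y p r w :: real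
    using that b by (simp add: field_simps power2_eq_square)
  have *: "((2 * real n + 2)\<^sup>2 * (4 ^ Suc n / ((real n + 1)\<^sup>2 * b) / 4 ^ Suc m * x) +
       4 ^ Suc n / ((real n + 1)\<^sup>2 * b) / 4 ^ Suc m * (4 * y)) /
      ((2 * real n + 3) * (2 * real n + 4)) =
    4 ^ Suc (Suc n) / ((real (Suc n) + 1)\<^sup>2 * real ((2 * Suc (Suc n)) choose Suc (Suc n))) /
      4 ^ Suc m * (x + y / (real n + 1)\<^sup>2)" for x y
    unfolding central_binomial_Suc[of "Suc n"] b_def[symmetric]
    using alg[of "2 * real n + 3" "4 ^ Suc n" "real n + 1" "real n + 2" "4 ^ Suc m" x y]
    by (simp add: algebra_simps)
  \<comment> \<open>Brings the term from row \<open>m - 1\<close> to the common denominator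
    \<open>4 ^ Suc m\<close>; the extra 4 meets \<open>(2n + 2)^2\<close> in the identity
    above.\<close>
  have shift: "a / 4 ^ Suc (m - 1) * y = a / 4 ^ Suc m * (4 * y)" if "m \<ge> 1" for a y :: real
    using that by (cases m) simp_all
  show ?case
  proof (cases "m \<ge> 1")
    case True
    show ?thesis
      unfolding rec Suc.IH t b_def[symmetric] if_P[OF True] shift[OF True] by (rule *)
  next
    case False
    show ?thesis
      unfolding rec Suc.IH t b_def[symmetric] if_not_P[OF False]
      using *[of "zeta2 n m" 0] by (simp only: mult_zero_right div_0 add_0_right)
  qed
qed

section \<open>The power series of arcsin powers in the open unit disc\<close>

lemma deriv_Arcsin_power:
  assumes "norm z < 1"
  shows "((\<lambda>z. Arcsin z ^ Suc k / fact (Suc k)) has_field_derivative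
    Arcsin z ^ k / fact k * inverse (cos (Arcsin z))) (at z)"
proof -
  have "\<bar>Re z\<bar> < 1"
    using assms abs_Re_le_cmod[of z] by linarith
  then have "((\<lambda>z. Arcsin z ^ Suc k / fact (Suc k)) has_field_derivative
      of_nat (Suc k) * (inverse (cos (Arcsin z)) * Arcsin z ^ k) / fact (Suc k)) (at z)"
    using DERIV_cdivide[OF DERIV_power[OF has_field_derivative_Arcsin], of z "Suc k" "fact (Suc k)"]
    by (simp del: power_Suc of_nat_Suc fact_Suc)
  moreover have "of_nat (Suc k) * (inverse (cos (Arcsin z)) * Arcsin z ^ k) / fact (Suc k) =
      Arcsin z ^ k / fact k * inverse (cos (Arcsin z))"
    by (simp add: fact_Suc del: of_nat_Suc)
  ultimately show ?thesis by simp
qed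

text \<open>With \<open>q = 1 / cos (Arcsin z)\<close>, one has \<open>h_(k+1)' = h_k * q\<close>,
  \<open>q' = z * q^3\<close> and \<open>(1 - z^2) * q^2 = 1\<close>. Differentiating twice and
  multiplying by \<open>1 - z^2\<close> removes all higher powers of \<open>q\<close>.\<close>

lemma Arcsin_power_ode:
  fixes h :: "nat \<Rightarrow> complex \<Rightarrow> complex"
  defines "h \<equiv> \<lambda>k z. Arcsin z ^ k / fact k"
  assumes z: "norm z < 1"
  shows "(1 - z\<^sup>2) * deriv (deriv (h k)) z - z * deriv (h k) z = (if k \<ge> 2 then h (k - 2) z else 0)"
proof -
  define q where "q z = inverse (cos (Arcsin z))" for z
  have h: "(h (Suc k) has_field_derivative h k z * q z) (at z)" if "norm z < 1" for k z
    using deriv_Arcsin_power[OF that, of k] by (simp add: h_def q_def)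
  have h0: "(h 0 has_field_derivative 0) (at z)" for z
    by (simp add: h_def)
  have cos2: "cos (Arcsin z) \<noteq> 0" "(cos (Arcsin z))\<^sup>2 = 1 - z\<^sup>2" if "norm z < 1" for z
  proof -
    show "(cos (Arcsin z))\<^sup>2 = 1 - z\<^sup>2" by (simp add: cos_squared_eq)
    show "cos (Arcsin z) \<noteq> 0"
      using that by (intro cos_Arcsin_nonzero) (auto simp: power2_eq_1_iff)
  qed
  have q: "(q has_field_derivative z * q z ^ 3) (at z)" if "norm z < 1" for z
  proof -
    have "\<bar>Re z\<bar> < 1" using that abs_Re_le_cmod[of z] by linarith
    then show ?thesis
      unfolding q_def using cos2[OF that]
      by (auto intro!: derivative_eq_intros simp: field_simps power3_eq_cube)
  qed
  have q2: "(1 - z\<^sup>2) * (q z)\<^sup>2 = 1" 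
    using cos2[OF z] by (simp add: q_def field_simps)
  \<comment> \<open>The formula for the first derivative holds on the whole disc, hence near
    \<open>z\<close>, and so may be differentiated again.\<close>
  have dd: "deriv (deriv (h k)) z = D"
    if "\<And>w. norm w < 1 \<Longrightarrow> deriv (h k) w = g w" "(g has_field_derivative D) (at z)" for g D k
  proof -
    have "\<forall>\<^sub>F w in nhds z. deriv (h k) w = g w"
      using z that(1) by (intro eventually_nhds_in_open[THEN eventually_mono, of "ball 0 1"]) auto
    then show ?thesis
      using that(2) by (metis DERIV_imp_deriv deriv_cong_ev)
  qed
  consider "k = 0" | "k = 1" | n where "k = Suc (Suc n)"
    by (metis One_nat_def not0_implies_Suc)
  then show ?thesis
  proof cases
    case 1
    have "deriv (h 0) w = 0" for w
      using h0 by (rule DERIV_imp_deriv)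
    then show ?thesis
      using 1 dd[of 0 "\<lambda>_. 0" 0] by simp
  next
    case 2
    have d: "deriv (h 1) w = q w" if "norm w < 1" for w
      using DERIV_imp_deriv[OF h[OF that, of 0]] by (simp add: h_def)
    have "deriv (deriv (h 1)) z = z * q z ^ 3"
      using d q[OF z] by (rule dd)
    moreover have "(1 - z\<^sup>2) * (z * q z ^ 3) = z * q z * ((1 - z\<^sup>2) * (q z)\<^sup>2)"
      by (simp add: algebra_simps power2_eq_square power3_eq_cube)
    ultimately show ?thesis using 2 d[OF z] q2 by simp
  next
    case 3
    have d: "deriv (h k) w = h (Suc n) w * q w" if "norm w < 1" for w
      using DERIV_imp_deriv[OF h[OF that, of "Suc n"]] by (simp add: 3)
    have "deriv (deriv (h k)) z = h (Suc n) z * (z * q z ^ 3) + h n z * q z * q z"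
      using d DERIV_mult'[OF h[OF z] q[OF z]] by (rule dd)
    moreover have "(1 - z\<^sup>2) * (h (Suc n) z * (z * q z ^ 3) + h n z * q z * q z) =
        z * (h (Suc n) z * q z) * ((1 - z\<^sup>2) * (q z)\<^sup>2) + h n z * ((1 - z\<^sup>2) * (q z)\<^sup>2)"
      by (simp add: algebra_simps power2_eq_square power3_eq_cube)
    ultimately show ?thesis using 3 d[OF z] q2 by simp
  qed
qed

text \<open>Comparing coefficients in the differential equation gives the recurrence defining
  \<open>arcsin_coeff\<close>, and the first two coefficients agree. Holomorphy on the unit disc
  provides convergence.\<close>

lemma Arcsin_power_sums:
  assumes z: "norm z < 1"
  shows "(\<lambda>j. of_real (arcsin_coeff k j) * z ^ j) sums (Arcsin z ^ k / fact k)"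
proof -
  define h where "h = (\<lambda>k z. Arcsin z ^ k / fact k)"
  define H where "H k = fps_expansion (h k) 0" for k
  have holo: "h k holomorphic_on ball 0 1" for k
  proof -
    have "Arcsin holomorphic_on ball 0 1"
    proof (rule holomorphic_on_Arcsin)
      fix z :: complex assume "z \<in> ball 0 1"
      then show "\<bar>Re z\<bar> < 1" using abs_Re_le_cmod[of z] by simp
    qed
    then show ?thesis unfolding h_def by (intro holomorphic_intros) auto
  qed
  have fps: "h k has_fps_expansion H k" for k
    unfolding H_def by (rule has_fps_expansion_fps_expansion[OF _ _ holo]) auto
  have ode: "(1 - fps_X\<^sup>2) * fps_deriv (fps_deriv (H k)) - fps_X * fps_deriv (H k) =
      (if k \<ge> 2 then H (k - 2) else 0)" for k
  proof (rule fps_expansion_unique_complex)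
    show "(\<lambda>z. (1 - z\<^sup>2) * deriv (deriv (h k)) z - z * deriv (h k) z) has_fps_expansion
        (1 - fps_X\<^sup>2) * fps_deriv (fps_deriv (H k)) - fps_X * fps_deriv (H k)"
      by (intro fps_expansion_intros fps)
    have "\<forall>\<^sub>F z in nhds 0. (1 - z\<^sup>2) * deriv (deriv (h k)) z - z * deriv (h k) z =
        (if k \<ge> 2 then h (k - 2) z else 0)"
      using Arcsin_power_ode unfolding h_def
      by (intro eventually_nhds_in_open[THEN eventually_mono, of "ball 0 1"]) auto
    moreover have "(\<lambda>z. if k \<ge> 2 then h (k - 2) z else 0) has_fps_expansion
        (if k \<ge> 2 then H (k - 2) else 0)"
      using fps by (cases "k \<ge> 2") auto
    ultimately show "(\<lambda>z. (1 - z\<^sup>2) * deriv (deriv (h k)) z - z * deriv (h k) z) has_fps_expansion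
        (if k \<ge> 2 then H (k - 2) else 0)"
      using has_fps_expansion_cong[OF _ refl] by fast
  qed
  have rec: "fps_nth (H k) (Suc (Suc j)) = ((of_nat j)\<^sup>2 * fps_nth (H k) j +
      (if k \<ge> 2 then fps_nth (H (k - 2)) j else 0)) / ((of_nat j + 1) * (of_nat j + 2))" for k j
  proof -
    have "fps_nth ((1 - fps_X\<^sup>2) * fps_deriv (fps_deriv (H k)) - fps_X * fps_deriv (H k)) j =
        fps_nth (if k \<ge> 2 then H (k - 2) else 0) j"
      by (simp add: ode)
    moreover have "fps_nth ((1 - fps_X\<^sup>2) * fps_deriv (fps_deriv (H k)) - fps_X * fps_deriv (H k)) j =
        (of_nat j + 1) * (of_nat j + 2) * fps_nth (H k) (Suc (Suc j)) - (of_nat j)\<^sup>2 * fps_nth (H k) j"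
    \<comment> \<open>The terms \<open>j * (j - 1)\<close> from \<open>X^2 * H''\<close> and
      \<open>j\<close> from \<open>X * H'\<close> add up to \<open>j^2\<close>; for
      \<open>j < 2\<close> the product with \<open>X^2\<close> contributes nothing.\<close>
    proof (cases "j < 2")
      case True
      then consider "j = 0" | "j = 1" by linarith
      then show ?thesis
        by cases (simp_all add: algebra_simps fps_X_power_mult_nth numeral_2_eq_2)
    next
      case False
      then obtain i where "j = Suc (Suc i)" by (metis add_2_eq_Suc' le_add_diff_inverse2 not_less)
      then show ?thesis
        by (simp add: algebra_simps fps_X_power_mult_nth power2_eq_square)
    qed
    ultimately have "(of_nat j + 1) * (of_nat j + 2) * fps_nth (H k) (Suc (Suc j)) =
        (of_nat j)\<^sup>2 * fps_nth (H k) j + (if k \<ge> 2 then fps_nth (H (k - 2)) j else 0)"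
      by (simp add: algebra_simps split: if_splits)
    moreover have "(of_nat j + 1) * (of_nat j + 2) = (of_nat ((j + 1) * (j + 2)) :: complex)"
      by (simp add: algebra_simps)
    then have "(of_nat j + 1) * (of_nat j + 2) \<noteq> (0 :: complex)"
      by (simp only: of_nat_eq_0_iff) simp
    ultimately show ?thesis
      by (metis nonzero_mult_div_cancel_left)
  qed
  have H: "fps_nth (H k) j = of_real (arcsin_coeff k j)" for k j
  proof (induction k j rule: arcsin_coeff.induct)
    case (1 k)
    then show ?case
      using fps_nth_fps_expansion[OF fps, of k 0] by (simp add: h_def)
  next
    case (2 k)
    have "fps_nth (H k) (Suc 0) = deriv (h k) 0"
      using fps_nth_fps_expansion[OF fps, of k "Suc 0"] by simp
    also have "\<dots> = (if k = 1 then 1 else 0)"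
    proof (cases k)
      case 0
      then show ?thesis by (simp add: h_def)
    next
      case (Suc i)
      have "deriv (h k) 0 = 0 ^ i / fact i"
        using DERIV_imp_deriv[OF deriv_Arcsin_power[of 0 i]] by (simp add: Suc h_def)
      then show ?thesis by (simp add: Suc power_0_left)
    qed
    finally show ?case by simp
  next
    case (3 k j)
    then show ?case unfolding rec by simp
  qed
  have "(\<lambda>j. (deriv ^^ j) (h k) 0 / fact j * (z - 0) ^ j) sums h k z"
    using z by (intro holomorphic_power_series[OF holo]) auto
  moreover have "(deriv ^^ j) (h k) 0 / fact j = of_real (arcsin_coeff k j)" for j
    using fps_nth_fps_expansion[OF fps, of k j] H by simp
  ultimately show ?thesis by (simp only: h_def diff_zero)
qed

section \<open>Real series for arcsin and arsinh powers below 1\<close>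

text \<open>Only zero terms are dropped. From here on \<open>e\<close> is 0 or 1, so that even and
  odd powers are treated together.\<close>

lemma sums_parity_subseq:
  fixes f :: "nat \<Rightarrow> 'a :: real_normed_vector"
  assumes "f sums c" "e \<le> 1" "\<And>j. odd (e + j) \<Longrightarrow> f j = 0"
  shows "(\<lambda>n. f (2 * n + e)) sums c"
proof -
  have "strict_mono (\<lambda>n. 2 * n + e)" by (simp add: strict_mono_def)
  moreover have "f j = 0" if "j \<notin> range (\<lambda>n. 2 * n + e)" for j
  proof (rule assms(3), rule ccontr)
    assume "\<not> odd (e + j)"
    moreover have "e = 0 \<or> e = 1" using assms(2) by linarith
    ultimately have "j = 2 * (j div 2) + e" by presburger
    with that show False by blast
  qed
  ultimately show ?thesis using sums_mono_reindex assms(1) by blast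
qed

lemma arcsin_power_sums_less_1:
  fixes x :: real
  assumes "0 \<le> x" "x < 1" "e \<le> 1"
  shows "(\<lambda>n. arcsin_coeff (2 * m + e) (2 * n + e) * x ^ (2 * n + e)) sums
    (arcsin x ^ (2 * m + e) / fact (2 * m + e))"
proof -
  have "(\<lambda>n. complex_of_real (arcsin_coeff (2 * m + e) (2 * n + e)) * of_real x ^ (2 * n + e)) sums
      (Arcsin (of_real x) ^ (2 * m + e) / fact (2 * m + e))"
    using assms by (intro sums_parity_subseq Arcsin_power_sums) (auto simp: arcsin_coeff_eq_0)
  also have "Arcsin (of_real x) ^ (2 * m + e) / fact (2 * m + e) =
      of_real (arcsin x ^ (2 * m + e) / fact (2 * m + e))"
    using assms by (simp add: of_real_arcsin)
  finally show ?thesis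
    by (simp only: flip: of_real_power of_real_mult) (simp only: sums_of_real_iff)
qed

text \<open>From \<open>sin (\<i> * y) = \<i> * sinh y\<close>; the value has real part 0 and so
  lies in the principal strip.\<close>

lemma Arcsin_ii_times: "Arcsin (\<i> * of_real x) = \<i> * of_real (arsinh x)"
proof (rule Arcsin_unique)
  have "sinh (complex_of_real (arsinh x)) = of_real (sinh (arsinh x))"
    unfolding sinh_field_def by (simp add: exp_of_real flip: of_real_minus)
  then show "sin (\<i> * complex_of_real (arsinh x)) = \<i> * of_real x"
    using sinh_conv_sin[of "complex_of_real (arsinh x)"]
    by (metis complex_i_mult_minus minus_minus mult_minus_left mult_minus_right sinh_arsinh_real)
qed auto

lemma arsinh_power_sums_less_1:
  fixes x :: real
  assumes "0 \<le> x" "x < 1" "e \<le> 1"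
  shows "(\<lambda>n. (-1) ^ n * arcsin_coeff (2 * m + e) (2 * n + e) * x ^ (2 * n + e)) sums
    ((-1) ^ m * arsinh x ^ (2 * m + e) / fact (2 * m + e))"
proof -
  \<comment> \<open>The factor \<open>\<i> ^ e\<close> is common to all terms and to the limit and
    cancels; the rest is the sign \<open>(-1) ^ n\<close>.\<close>
  have i: "(\<i> * of_real y) ^ (2 * n + e) = \<i> ^ e * of_real ((-1) ^ n * y ^ (2 * n + e))" for y n
    by (simp add: power_mult_distrib power_add power_mult power_minus[of "(of_real y)\<^sup>2"])
  have "(\<lambda>n. complex_of_real (arcsin_coeff (2 * m + e) (2 * n + e)) * (\<i> * of_real x) ^ (2 * n + e)) sums
      (Arcsin (\<i> * of_real x) ^ (2 * m + e) / fact (2 * m + e))"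
    using assms by (intro sums_parity_subseq Arcsin_power_sums)
      (auto simp: arcsin_coeff_eq_0 norm_mult)
  then have "(\<lambda>n. \<i> ^ e * complex_of_real ((-1) ^ n * arcsin_coeff (2 * m + e) (2 * n + e) * x ^ (2 * n + e)))
      sums (\<i> ^ e * of_real ((-1) ^ m * arsinh x ^ (2 * m + e) / fact (2 * m + e)))"
    unfolding Arcsin_ii_times i by (simp add: mult_ac)
  then have "(\<lambda>n. complex_of_real ((-1) ^ n * arcsin_coeff (2 * m + e) (2 * n + e) * x ^ (2 * n + e)))
      sums of_real ((-1) ^ m * arsinh x ^ (2 * m + e) / fact (2 * m + e))"
    by (rule iffD1[OF sums_mult_iff, rotated]) simp
  then show ?thesis
    by (rule iffD1[OF sums_of_real_iff])
qed

section \<open>Extension of the series to the boundary point 1\<close>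

text \<open>For \<open>x < 1\<close> a partial sum of nonnegative terms is at most
  \<open>g x\<close>; letting \<open>x\<close> tend to 1 bounds the partial sums of \<open>c\<close>
  by \<open>g 1\<close>.\<close>

lemma summable_of_powser_nonneg:
  fixes c g :: "_ \<Rightarrow> real"
  assumes nonneg: "\<And>n. c n \<ge> 0"
    and sums: "\<And>x. 0 \<le> x \<Longrightarrow> x < 1 \<Longrightarrow> (\<lambda>n. c n * x ^ p n) sums g x"
    and g: "continuous_on {0..1} g"
  shows "summable c"
proof (rule summableI_nonneg_bounded)
  fix N
  have "((\<lambda>x. \<Sum>n<N. c n * x ^ p n) \<longlongrightarrow> (\<Sum>n<N. c n * 1 ^ p n)) (at_left 1)"
    by (intro tendsto_intros)
  moreover have "(g \<longlongrightarrow> g 1) (at_left 1)"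
    using continuous_on_Icc_at_leftD[OF g] by simp
  moreover have "\<forall>\<^sub>F x in at_left 1. (\<Sum>n<N. c n * x ^ p n) \<le> g x"
  proof -
    have "\<forall>\<^sub>F x in at_left (1::real). x \<in> {0<..<1}"
      by (rule eventually_at_left_real) simp
    then show ?thesis
    proof eventually_elim
      case (elim x)
      then show ?case
        using sums[of x] sum_le_suminf[of "\<lambda>n. c n * x ^ p n" "{..<N}"] nonneg
        by (auto simp: sums_iff)
    qed
  qed
  ultimately show "(\<Sum>n<N. c n) \<le> g 1"
    using tendsto_le[OF trivial_limit_at_left_real] by fastforce
qed (fact nonneg)

text \<open>By the Weierstrass test the sum is continuous on the closed interval, so its agreement
  with \<open>g\<close> below 1 persists at 1. The separate majorant \<open>b\<close> admits
  coefficients with signs.\<close>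

lemma powser_sums_at_1:
  fixes c b g :: "_ \<Rightarrow> real"
  assumes bound: "\<And>n. \<bar>c n\<bar> \<le> b n" and b: "summable b"
    and sums: "\<And>x. 0 \<le> x \<Longrightarrow> x < 1 \<Longrightarrow> (\<lambda>n. c n * x ^ p n) sums g x"
    and g: "continuous_on {0..1} g"
  shows "c sums g 1"
proof -
  define S where "S x = (\<Sum>n. c n * x ^ p n)" for x
  have "uniform_limit {0..1} (\<lambda>N x. \<Sum>n<N. c n * x ^ p n) S sequentially"
    unfolding S_def
  proof (rule Weierstrass_m_test[OF _ b])
    fix n and x :: real assume "x \<in> {0..1}"
    then have "\<bar>c n\<bar> * \<bar>x ^ p n\<bar> \<le> b n * 1"
      using bound[of n] by (intro mult_mono) (auto intro: power_le_one)
    then show "norm (c n * x ^ p n) \<le> b n" by (simp add: abs_mult)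
  qed
  then have "continuous_on {0..1} S"
    by (rule uniform_limit_theorem[rotated]) (auto intro!: always_eventually continuous_intros)
  then have "(S \<longlongrightarrow> S 1) (at_left 1)"
    by (rule continuous_on_Icc_at_leftD) simp
  moreover have "\<forall>\<^sub>F x in at_left 1. S x = g x"
  proof -
    have "\<forall>\<^sub>F x in at_left (1::real). x \<in> {0<..<1}"
      by (rule eventually_at_left_real) simp
    then show ?thesis
      by eventually_elim (use sums in \<open>auto simp: S_def sums_iff\<close>)
  qed
  ultimately have "(g \<longlongrightarrow> S 1) (at_left 1)"
    using tendsto_cong by fast
  moreover have "(g \<longlongrightarrow> g 1) (at_left 1)"
    using continuous_on_Icc_at_leftD[OF g] by simp
  ultimately have "S 1 = g 1"
    by (intro tendsto_unique) auto
  moreover have "summable c"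
    using summable_comparison_test'[OF b, of 0 c] bound by simp
  ultimately show ?thesis by (simp add: S_def sums_iff)
qed

lemma summable_arcsin_coeff:
  assumes "e \<le> 1"
  shows "summable (\<lambda>n. arcsin_coeff (2 * m + e) (2 * n + e))"
  using arcsin_coeff_nonneg arcsin_power_sums_less_1[OF _ _ assms]
  by (rule summable_of_powser_nonneg) (auto intro!: continuous_intros)

lemma arcsin_power_sums:
  fixes x :: real
  assumes "0 \<le> x" "x \<le> 1" "e \<le> 1"
  shows "(\<lambda>n. arcsin_coeff (2 * m + e) (2 * n + e) * x ^ (2 * n + e)) sums
    (arcsin x ^ (2 * m + e) / fact (2 * m + e))"
proof (cases "x = 1")
  case True
  have "(\<lambda>n. arcsin_coeff (2 * m + e) (2 * n + e)) sums
      (arcsin 1 ^ (2 * m + e) / fact (2 * m + e))"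
    by (rule powser_sums_at_1[OF _ summable_arcsin_coeff[OF assms(3)]
          arcsin_power_sums_less_1[OF _ _ assms(3)]])
      (auto simp: arcsin_coeff_nonneg intro!: continuous_intros)
  with True show ?thesis by simp
qed (use arcsin_power_sums_less_1 assms in auto)

lemma arsinh_power_sums:
  fixes x :: real
  assumes "0 \<le> x" "x \<le> 1" "e \<le> 1"
  shows "(\<lambda>n. (-1) ^ n * arcsin_coeff (2 * m + e) (2 * n + e) * x ^ (2 * n + e)) sums
    ((-1) ^ m * arsinh x ^ (2 * m + e) / fact (2 * m + e))"
proof (cases "x = 1")
  case True
  have "(\<lambda>n. (-1) ^ n * arcsin_coeff (2 * m + e) (2 * n + e)) sums
      ((-1) ^ m * arsinh 1 ^ (2 * m + e) / fact (2 * m + e))"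
    \<comment> \<open>The majorant of the alternating series is again the unsigned
      \<open>arcsin_coeff\<close>, summable by the arcsin case.\<close>
    by (rule powser_sums_at_1[OF _ summable_arcsin_coeff[OF assms(3)]
          arsinh_power_sums_less_1[OF _ _ assms(3)]])
      (auto simp: arcsin_coeff_nonneg abs_mult intro!: continuous_intros)
  with True show ?thesis by simp
qed (use arsinh_power_sums_less_1 assms in auto)

section \<open>Separation of even and odd indices, and the four series\<close>

lemma sums_even_odd_split:
  fixes f :: "nat \<Rightarrow> real"
  assumes "f sums P" "(\<lambda>n. (-1) ^ n * f n) sums Q"
  shows "(\<lambda>r. f (2 * r)) sums ((P + Q) / 2)" "(\<lambda>r. f (2 * r + 1)) sums ((P - Q) / 2)"
proof -
  have "(\<lambda>n. (f n + (-1) ^ n * f n) / 2) sums ((P + Q) / 2)"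
    by (intro sums_divide sums_add assms)
  from sums_parity_subseq[OF this, of 0] show "(\<lambda>r. f (2 * r)) sums ((P + Q) / 2)"
    by simp
  have "(\<lambda>n. (f n - (-1) ^ n * f n) / 2) sums ((P - Q) / 2)"
    by (intro sums_divide sums_diff assms)
  from sums_parity_subseq[OF this, of 1] show "(\<lambda>r. f (2 * r + 1)) sums ((P - Q) / 2)"
    by simp
qed

text \<open>The common source of the four series: \<open>e = 1\<close> leads to those with
  \<open>t2\<close>, \<open>e = 0\<close> to those with \<open>zeta2\<close>.\<close>

lemma arcsin_arsinh_power_sums:
  fixes x :: real
  assumes "0 \<le> x" "x \<le> 1" "e \<le> 1"
  shows "(\<lambda>r. arcsin_coeff (2 * m + e) (2 * (2 * r) + e) * x ^ (2 * (2 * r) + e)) sums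
      ((arcsin x ^ (2 * m + e) + (-1) ^ m * arsinh x ^ (2 * m + e)) / (2 * fact (2 * m + e)))"
    and "(\<lambda>r. arcsin_coeff (2 * m + e) (2 * (2 * r + 1) + e) * x ^ (2 * (2 * r + 1) + e)) sums
      ((arcsin x ^ (2 * m + e) - (-1) ^ m * arsinh x ^ (2 * m + e)) / (2 * fact (2 * m + e)))"
proof -
  have f: "(p / fact k + y / fact k) / 2 = (p + y) / (2 * fact k)"
    "(p / fact k - y / fact k) / 2 = (p - y) / (2 * fact k)" for p y :: real and k
    by (simp_all add: add_divide_distrib diff_divide_distrib)
  note split = sums_even_odd_split[OF arcsin_power_sums[OF assms]
      arsinh_power_sums[OF assms, unfolded mult.assoc], of m, unfolded f]
  show "(\<lambda>r. arcsin_coeff (2 * m + e) (2 * (2 * r) + e) * x ^ (2 * (2 * r) + e)) sums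
      ((arcsin x ^ (2 * m + e) + (-1) ^ m * arsinh x ^ (2 * m + e)) / (2 * fact (2 * m + e)))"
    by (rule split(1))
  show "(\<lambda>r. arcsin_coeff (2 * m + e) (2 * (2 * r + 1) + e) * x ^ (2 * (2 * r + 1) + e)) sums
      ((arcsin x ^ (2 * m + e) - (-1) ^ m * arsinh x ^ (2 * m + e)) / (2 * fact (2 * m + e)))"
    by (rule split(2))
qed

theorem theorem7p1:
  fixes u \<sigma> A B :: real
  assumes "0 < u" and "u \<le> 1"
    and "\<sigma> = u powr (1 / 4)" and "A = arcsin \<sigma>" and "B = arsinh \<sigma>"
  shows "(\<forall>m::nat.
      (\<lambda>r. real ((4 * r) choose (2 * r)) / (16 ^ r * (4 * real r + 1)) * t2 (2 * r) m * u ^ r)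
        sums ((A ^ (2 * m + 1) + (-1) ^ m * B ^ (2 * m + 1)) / (2 * fact (2 * m + 1) * \<sigma>))
    \<and> (\<lambda>r. real ((4 * r + 2) choose (2 * r + 1)) / (2 ^ (4 * r + 2) * (4 * real r + 3))
            * t2 (2 * r + 1) m * u ^ r)
        sums ((A ^ (2 * m + 1) - (-1) ^ m * B ^ (2 * m + 1)) / (2 * fact (2 * m + 1) * \<sigma> ^ 3)))
    \<and> (\<forall>m::nat. m \<ge> 1 \<longrightarrow>
      (\<lambda>k. let r = k + 1 in
            16 ^ r * u ^ r / ((real r)\<^sup>2 * real ((4 * r) choose (2 * r))) * zeta2 (2 * r - 1) (m - 1))
        sums (2 ^ (2 * m + 1) / fact (2 * m) * (A ^ (2 * m) + (-1) ^ m * B ^ (2 * m)))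
    \<and> (\<lambda>r. 4 ^ (2 * r + 1) * u ^ r
            / ((2 * real r + 1)\<^sup>2 * real ((4 * r + 2) choose (2 * r + 1))) * zeta2 (2 * r) (m - 1))
        sums (2 ^ (2 * m - 1) / (\<sigma>\<^sup>2 * fact (2 * m)) * (A ^ (2 * m) - (-1) ^ m * B ^ (2 * m))))"
proof -
  have \<sigma>: "\<sigma> > 0" "\<sigma> \<le> 1"
    using assms by (auto simp: powr_le1)
  have u: "u ^ r = \<sigma> ^ (4 * r)" for r
    using assms(1) by (simp add: assms(3) power_mult powr_powr flip: powr_realpow)
  note series = arcsin_arsinh_power_sums[of \<sigma>, folded assms(4,5)]
  have 1: "(\<lambda>r. real ((4 * r) choose (2 * r)) / (16 ^ r * (4 * real r + 1)) * t2 (2 * r) m * u ^ r)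
        sums ((A ^ (2 * m + 1) + (-1) ^ m * B ^ (2 * m + 1)) / (2 * fact (2 * m + 1) * \<sigma>))" for m
  proof -
    have "real ((4 * r) choose (2 * r)) / (16 ^ r * (4 * real r + 1)) * t2 (2 * r) m * u ^ r =
        arcsin_coeff (2 * m + 1) (2 * (2 * r) + 1) * \<sigma> ^ (2 * (2 * r) + 1) / \<sigma>" for r
      using \<sigma> unfolding arcsin_coeff_odd u by (simp add: power_mult)
    then show ?thesis
      using sums_divide[OF series(1)[of 1 m], of \<sigma>] \<sigma>
      by (simp only: divide_divide_eq_left less_imp_le order_refl)
  qed
  have 2: "(\<lambda>r. real ((4 * r + 2) choose (2 * r + 1)) / (2 ^ (4 * r + 2) * (4 * real r + 3))
            * t2 (2 * r + 1) m * u ^ r)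
        sums ((A ^ (2 * m + 1) - (-1) ^ m * B ^ (2 * m + 1)) / (2 * fact (2 * m + 1) * \<sigma> ^ 3))" for m
  proof -
    have eq: "2 * (2 * r + 1) = 4 * r + 2" for r :: nat by simp
    have c: "arcsin_coeff (2 * m + 1) (4 * r + 2 + 1) =
        real ((4 * r + 2) choose (2 * r + 1)) / (2 ^ (4 * r + 2) * (4 * real r + 3)) *
          t2 (2 * r + 1) m" for r
    proof -
      have "(4::real) ^ (2 * r + 1) = 2 ^ (4 * r + 2)"
        using power_mult[of "2::real" 2 "2 * r + 1"] by simp
      moreover have "2 * real (2 * r + 1) + 1 = 4 * real r + 3"
        by simp
      ultimately show ?thesis
        using arcsin_coeff_odd[of m "2 * r + 1"] by (simp only: eq)
    qed
    \<comment> \<open>The exponent is \<open>4 * r + 3\<close>, so dividing by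
      \<open>\<sigma> ^ 3\<close> leaves \<open>u ^ r\<close>.\<close>
    have "real ((4 * r + 2) choose (2 * r + 1)) / (2 ^ (4 * r + 2) * (4 * real r + 3))
            * t2 (2 * r + 1) m * u ^ r =
        arcsin_coeff (2 * m + 1) (2 * (2 * r + 1) + 1) * \<sigma> ^ (2 * (2 * r + 1) + 1) / \<sigma> ^ 3" for r
    proof -
      have "\<sigma> ^ (4 * r + 2 + 1) = \<sigma> ^ (4 * r) * \<sigma> ^ 3"
        by (simp only: power_add power3_eq_cube power2_eq_square power_one_right mult.assoc)
      then show ?thesis
        unfolding eq c u using \<sigma> by (simp only:) simp
    qed
    then show ?thesis
      using sums_divide[OF series(2)[of 1 m], of "\<sigma> ^ 3"] \<sigma>
      by (simp only: divide_divide_eq_left less_imp_le order_refl)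
  qed
  have 3: "(\<lambda>k. let r = k + 1 in
            16 ^ r * u ^ r / ((real r)\<^sup>2 * real ((4 * r) choose (2 * r))) * zeta2 (2 * r - 1) (m - 1))
        sums (2 ^ (2 * m + 1) / fact (2 * m) * (A ^ (2 * m) + (-1) ^ m * B ^ (2 * m)))"
    if m1: "m \<ge> 1" for m
  proof -
    obtain l where m: "m = Suc l" using m1 by (cases m) auto
    let ?f = "\<lambda>r. arcsin_coeff (2 * m) (2 * (2 * r)) * \<sigma> ^ (2 * (2 * r))"
    have "?f sums ((A ^ (2 * m) + (-1) ^ m * B ^ (2 * m)) / (2 * fact (2 * m)))"
      using series(1)[of 0 m] \<sigma> by simp
    \<comment> \<open>Since \<open>m\<close> is positive, the term of index 0 vanishes and the sum
      may start at \<open>r = 1\<close>.\<close>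
    then have "(\<lambda>k. ?f (Suc k)) sums ((A ^ (2 * m) + (-1) ^ m * B ^ (2 * m)) / (2 * fact (2 * m)))"
      by (subst sums_Suc_iff) (simp add: m)
    \<comment> \<open>The factor \<open>4 ^ m\<close> clears the normalisation of the coefficients;
      the other 4 turns \<open>(2 * r)^2\<close> into \<open>r^2\<close>.\<close>
    then have "(\<lambda>k. 4 * 4 ^ m * ?f (Suc k)) sums
        (4 * 4 ^ m * ((A ^ (2 * m) + (-1) ^ m * B ^ (2 * m)) / (2 * fact (2 * m))))"
      by (rule sums_mult)
    moreover have "4 * 4 ^ m * ?f (Suc k) = (let r = k + 1 in
        16 ^ r * u ^ r / ((real r)\<^sup>2 * real ((4 * r) choose (2 * r))) * zeta2 (2 * r - 1) (m - 1))" for k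
    proof -
      have c: "arcsin_coeff (2 * m) (2 * (2 * Suc k)) =
          4 ^ (2 * Suc k) / ((2 * real (Suc k))\<^sup>2 * real ((4 * Suc k) choose (2 * Suc k))) / 4 ^ m *
          zeta2 (2 * Suc k - 1) (m - 1)"
      proof -
        have "Suc (2 * k + 1) = 2 * Suc k" "2 * (2 * Suc k) = 4 * Suc k" "2 * Suc k - 1 = 2 * k + 1"
            "m - 1 = l"
          and "real (2 * k + 1) + 1 = 2 * real (Suc k)"
          by (auto simp: m)
        then show ?thesis
          using arcsin_coeff_even[of l "2 * k + 1"] by (simp only: m)
      qed
      have "(4::real) ^ (2 * Suc k) = 16 ^ Suc k"
        by (simp add: power_mult)
      moreover have "2 * (2 * Suc k) = 4 * Suc k"
        by simp
      moreover have "4 * w * (q / ((2 * a)\<^sup>2 * b) / w * z * s) = q * s / (a\<^sup>2 * b) * z"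
        if "w \<noteq> 0" for w q a b z s :: real
        using that by (simp add: power_mult_distrib)
      ultimately show ?thesis
        unfolding c u Let_def Suc_eq_plus1[symmetric] by (simp only: power_not_zero numeral_neq_zero not_False_eq_True)
    qed
    moreover have "4 * 4 ^ m * ((A ^ (2 * m) + (-1) ^ m * B ^ (2 * m)) / (2 * fact (2 * m))) =
        2 ^ (2 * m + 1) / fact (2 * m) * (A ^ (2 * m) + (-1) ^ m * B ^ (2 * m))"
      by (simp add: power_mult)
    ultimately show ?thesis by (simp only:)
  qed
  have 4: "(\<lambda>r. 4 ^ (2 * r + 1) * u ^ r
            / ((2 * real r + 1)\<^sup>2 * real ((4 * r + 2) choose (2 * r + 1))) * zeta2 (2 * r) (m - 1))
        sums (2 ^ (2 * m - 1) / (\<sigma>\<^sup>2 * fact (2 * m)) * (A ^ (2 * m) - (-1) ^ m * B ^ (2 * m)))"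
    if m1: "m \<ge> 1" for m
  proof -
    obtain l where m: "m = Suc l" using m1 by (cases m) auto
    let ?f = "\<lambda>r. arcsin_coeff (2 * m) (2 * (2 * r + 1)) * \<sigma> ^ (2 * (2 * r + 1))"
    have "?f sums ((A ^ (2 * m) - (-1) ^ m * B ^ (2 * m)) / (2 * fact (2 * m)))"
      using series(2)[of 0 m] \<sigma> by simp
    \<comment> \<open>The exponent is \<open>4 * r + 2\<close>, hence the division by
      \<open>\<sigma>^2\<close>; the square \<open>(2 * r + 1)^2\<close> stays, so no further 4
      appears.\<close>
    then have "(\<lambda>r. 4 ^ m / \<sigma>\<^sup>2 * ?f r) sums
        (4 ^ m / \<sigma>\<^sup>2 * ((A ^ (2 * m) - (-1) ^ m * B ^ (2 * m)) / (2 * fact (2 * m))))"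
      by (rule sums_mult)
    moreover have "4 ^ m / \<sigma>\<^sup>2 * ?f r = 4 ^ (2 * r + 1) * u ^ r
            / ((2 * real r + 1)\<^sup>2 * real ((4 * r + 2) choose (2 * r + 1))) * zeta2 (2 * r) (m - 1)" for r
    proof -
      have c: "arcsin_coeff (2 * m) (2 * (2 * r + 1)) =
          4 ^ (2 * r + 1) / ((2 * real r + 1)\<^sup>2 * real ((4 * r + 2) choose (2 * r + 1))) / 4 ^ m *
          zeta2 (2 * r) (m - 1)"
      proof -
        have "Suc (2 * r) = 2 * r + 1" "2 * (2 * r + 1) = 4 * r + 2" "m - 1 = l"
          and "real (2 * r) + 1 = 2 * real r + 1"
          by (auto simp: m)
        then show ?thesis
          using arcsin_coeff_even[of l "2 * r"] by (simp only: m)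
      qed
      have "\<sigma> ^ (2 * (2 * r + 1)) = \<sigma> ^ (4 * r) * \<sigma>\<^sup>2"
        by (simp add: power_add[symmetric])
      then show ?thesis
        unfolding c u using \<sigma>
        by (simp add: field_simps del: binomial_Suc_Suc power_Suc)
    qed
    moreover have "4 ^ m / \<sigma>\<^sup>2 * ((A ^ (2 * m) - (-1) ^ m * B ^ (2 * m)) / (2 * fact (2 * m))) =
        2 ^ (2 * m - 1) / (\<sigma>\<^sup>2 * fact (2 * m)) * (A ^ (2 * m) - (-1) ^ m * B ^ (2 * m))"
    proof -
      have "(4::real) ^ m = 2 * 2 ^ (2 * m - 1)"
        by (simp add: m power_mult)
      then show ?thesis by (simp only:) simp
    qed
    ultimately show ?thesis by (simp only:)
  qed
  show ?thesis
    using 1 2 3 4 by blast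
qed

end
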